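(* Let $a\in\mathbb R$ and $\tau>0$ satisfy $a\tau<1$, let $\hat{\boldsymbol x}\in\mathbb R^n$, and consider the approximating SDE $$(1-a\tau)\frac{\mathrm d\boldsymbol X(t)}{\mathrm dt}=-\nabla\tilde V(\boldsymbol X(t))+\boldsymbol\sigma(\boldsymbol X(t))\boldsymbol\xi(t),\qquad \tilde V(\boldsymbol x)=V(\boldsymbol x)+\frac a2|\boldsymbol x-\hat{\boldsymbol x}|^2,$$ where $\boldsymbol\xi(t)$ is the standard $m$-dimensional Ornstein–Uhlenbeck (OU) noise with correlation times $s_{cor}^{(1)},\dots,s_{cor}^{(m)}>0$. With the rescaled time $s=t/(1-a\tau)$, this SDE is equivalent to the rescaled SDE $$\frac{\mathrm d\boldsymbol X(s)}{\mathrm ds}=-\nabla\tilde V(\boldsymbol X(s))+\tilde{\boldsymbol\sigma}(\boldsymbol X(s))\,\tilde{\boldsymbol\xi}^{\mathrm{OU}}(s),$$ where the effective noise intensity is $$\tilde{\boldsymbol\sigma}(\boldsymbol x)=\frac{\boldsymbol\sigma(\boldsymbol x)}{\sqrt{1-a\tau}},$$ and $\tilde{\boldsymbol\xi}^{\mathrm{OU}}(s)$ is the rescaled standard OU noise (i.e. a standard $m$-dimensional OU noise in the time variable $s$) with correlation times $$\tilde s_{cor}^{(\ell)}=\frac{s_{cor}^{(\ell)}}{1-a\tau},\qquad \ell=1,\dots,m.$$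
   Context: Here $V:\mathbb R^n\to\mathbb R$ is a (differentiable) potential, $\boldsymbol X(t)\in\mathbb R^n$ is the state process, $\boldsymbol\sigma(\boldsymbol x)\in\mathbb R^{n\times m}$ is the noise intensity. Processes in rescaled time are denoted $\boldsymbol X(s):=\boldsymbol X((1-a\tau)s)$. Standard $m$-dimensional Gaussian white noise $\boldsymbol\xi^{\mathrm{WN}}$ is the zero-mean Gaussian (generalized) process with autocorrelation $\mathbb E[\boldsymbol\xi^{\mathrm{WN}}(t_1)(\boldsymbol\xi^{\mathrm{WN}}(t_2))^T]=\boldsymbol I\,\delta(t_1-t_2)$; it is the formal time derivative of the standard Wiener process. The standard $m$-dimensional OU noise with correlation times $s_{cor}^{(1)},\dots,s_{cor}^{(m)}$ is the process solving the linear filter $$\frac{\mathrm d\boldsymbol\xi(t)}{\mathrm dt}=-\boldsymbol A\boldsymbol\xi(t)+\boldsymbol A\boldsymbol\xi^{\mathrm{WN}}(t),\qquad \boldsymbol A=\mathrm{diag}\left[1/s_{cor}^{(1)},\dots,1/s_{cor}^{(m)}\right],$$ whose stationary autocorrelation is $$\boldsymbol C^{\mathrm{OU}}_{\boldsymbol\xi}(t_1,t_2)=\mathrm{diag}\left[\frac{1}{2s_{cor}^{(1)}}e^{-|t_1-t_2|/s_{cor}^{(1)}},\dots,\frac{1}{2s_{cor}^{(m)}}e^{-|t_1-t_2|/s_{cor}^{(m)}}\right].$$ *)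

theory Defs
  imports "HOL-Probability.Probability"
begin

definition diag_matrix :: "real ^ 'm \<Rightarrow> real ^ 'm ^ 'm" where
  "diag_matrix d = (\<chi> i j. if i = j then d $ i else 0)"

definition grad :: "('a::euclidean_space \<Rightarrow> real) \<Rightarrow> 'a \<Rightarrow> 'a" where
  "grad f x = (THE D. GDERIV f x :> D)"

(* Two-sided standard m-dimensional Wiener process (time set: all of the real line).
   The strictly increasing sequence t stands for an arbitrary finite partition: independence of
   an infinite family means independence of its finite subfamilies.  The index (k, l) makes
   the increments over different intervals and the m components jointly independent. *)
definition standard_wiener :: "'w measure \<Rightarrow> (real \<Rightarrow> 'w \<Rightarrow> real ^ 'm) \<Rightarrow> bool" where
  "standard_wiener M W \<longleftrightarrow>
     prob_space M \<and>
     (\<forall>t. W t \<in> borel_measurable M) \<and>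
     (AE \<omega> in M. W 0 \<omega> = 0) \<and>
     (AE \<omega> in M. continuous_on UNIV (\<lambda>t. W t \<omega>)) \<and>
     (\<forall>r t l. r < t \<longrightarrow>
        distributed M lborel (\<lambda>\<omega>. W t \<omega> $ l - W r \<omega> $ l) (normal_density 0 (sqrt (t - r)))) \<and>
     (\<forall>t::nat \<Rightarrow> real. strict_mono t \<longrightarrow>
        prob_space.indep_vars M (\<lambda>_. borel)
          (\<lambda>(k, l) \<omega>. W (t (Suc k)) \<omega> $ l - W (t k) \<omega> $ l) (UNIV :: (nat \<times> 'm) set))"

(* d xi / dt = - A xi + A xi_WN, where the white noise xi_WN is the formal derivative of W:
   the filter is integrated over every time interval. *)
definition solves_linear_filter ::
    "'w measure \<Rightarrow> real ^ 'm ^ 'm \<Rightarrow> (real \<Rightarrow> 'w \<Rightarrow> real ^ 'm) \<Rightarrow> (real \<Rightarrow> 'w \<Rightarrow> real ^ 'm) \<Rightarrow> bool" where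
  "solves_linear_filter M A W \<xi> \<longleftrightarrow>
     (\<forall>t. \<xi> t \<in> borel_measurable M) \<and>
     (AE \<omega> in M. continuous_on UNIV (\<lambda>t. \<xi> t \<omega>) \<and>
        (\<forall>r t. r \<le> t \<longrightarrow>
           \<xi> t \<omega> - \<xi> r \<omega> = - (A *v integral {r..t} (\<lambda>u. \<xi> u \<omega>)) + A *v (W t \<omega> - W r \<omega>)))"

definition autocorrelation ::
    "'w measure \<Rightarrow> (real \<Rightarrow> 'w \<Rightarrow> real ^ 'm) \<Rightarrow> real \<Rightarrow> real \<Rightarrow> real ^ 'm ^ 'm" where
  "autocorrelation M \<xi> t1 t2 = (\<chi> i j. \<integral>\<omega>. \<xi> t1 \<omega> $ i * \<xi> t2 \<omega> $ j \<partial>M)"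

(* The filter determines xi up to a transient; the autocorrelation clause selects the
   stationary solution. *)
definition standard_OU_noise ::
    "'w measure \<Rightarrow> real ^ 'm \<Rightarrow> (real \<Rightarrow> 'w \<Rightarrow> real ^ 'm) \<Rightarrow> bool" where
  "standard_OU_noise M scor \<xi> \<longleftrightarrow>
     (\<exists>W. standard_wiener M W \<and> solves_linear_filter M (diag_matrix (\<chi> l. 1 / scor $ l)) W \<xi>) \<and>
     (\<forall>t l. integrable M (\<lambda>\<omega>. (\<xi> t \<omega> $ l)\<^sup>2)) \<and>
     (\<forall>t1 t2. autocorrelation M \<xi> t1 t2 =
        diag_matrix (\<chi> l. 1 / (2 * scor $ l) * exp (- \<bar>t1 - t2\<bar> / scor $ l)))"

(* k dX/dt = - grad U (X) + S (X) eta on the time set T.  Noise with continuous paths makes this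
   a random differential equation, solved path by path; no stochastic integral is involved. *)
definition solves_sde ::
    "'w measure \<Rightarrow> real set \<Rightarrow> real \<Rightarrow> (real ^ 'n \<Rightarrow> real) \<Rightarrow> (real ^ 'n \<Rightarrow> real ^ 'm ^ 'n) \<Rightarrow>
     (real \<Rightarrow> 'w \<Rightarrow> real ^ 'm) \<Rightarrow> (real \<Rightarrow> 'w \<Rightarrow> real ^ 'n) \<Rightarrow> bool" where
  "solves_sde M T k U S \<eta> X \<longleftrightarrow>
     (\<forall>t\<in>T. X t \<in> borel_measurable M) \<and>
     (AE \<omega> in M. \<forall>t\<in>T. \<exists>D. ((\<lambda>t. X t \<omega>) has_vector_derivative D) (at t within T) \<and>
        k *\<^sub>R D = - grad U (X t \<omega>) + S (X t \<omega>) *v \<eta> t \<omega>)"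

definition tilted_potential ::
    "(real ^ 'n \<Rightarrow> real) \<Rightarrow> real \<Rightarrow> real ^ 'n \<Rightarrow> real ^ 'n \<Rightarrow> real" where
  "tilted_potential V a xhat = (\<lambda>x. V x + a / 2 * (norm (x - xhat))\<^sup>2)"

definition rescale_time :: "real \<Rightarrow> (real \<Rightarrow> 'w \<Rightarrow> 'b) \<Rightarrow> real \<Rightarrow> 'w \<Rightarrow> 'b" where
  "rescale_time c X = (\<lambda>s. X (c * s))"

(* The amplitude sqrt c is that of white noise in the time s, since
   delta (c * (s1 - s2)) = delta (s1 - s2) / c. *)
definition rescale_noise :: "real \<Rightarrow> (real \<Rightarrow> 'w \<Rightarrow> real ^ 'm) \<Rightarrow> real \<Rightarrow> 'w \<Rightarrow> real ^ 'm" where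
  "rescale_noise c \<xi> = (\<lambda>s \<omega>. sqrt c *\<^sub>R \<xi> (c * s) \<omega>)"

end

theory Submission
  imports Defs
begin

text \<open>
  The equivalence is a scaling symmetry. For every \<open>c > 0\<close> the substitution \<open>t = c * s\<close> maps each
  object to one of the same kind:

  \<^item> Brownian scaling: \<open>W (c * s) / sqrt c\<close> is again a standard Wiener process
    (\<open>standard_wiener_rescale\<close>).
  \<^item> The matching rescaled noise \<open>sqrt c * \<xi> (c * s)\<close> satisfies the linear filter driven by that
    process with matrix \<open>c A\<close>: one factor \<open>c\<close> comes from the time differential in the
    drift, and in the noise term \<open>c\<close> is \<open>sqrt c\<close> from the amplitude of the noise
    times \<open>sqrt c\<close> from the amplitude of the Wiener process (\<open>solves_linear_filter_rescale\<close>). The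
    matrix \<open>c A\<close> belongs to the correlation times divided by \<open>c\<close>, and the stationary
    autocorrelation scales in the same way, so standard OU noise goes to standard OU noise
    (\<open>standard_OU_noise_rescale\<close>).
  \<^item> By the chain rule, a solution of \<open>k X' = - grad U + S \<eta>\<close> becomes a solution with \<open>k / c\<close> and
    \<open>S / sqrt c\<close> in place of \<open>k\<close> and \<open>S\<close>, because the factor \<open>sqrt c\<close> gained by the noise is
    compensated in the intensity (\<open>solves_sde_rescale\<close>).

  These maps form an action of the multiplicative group of positive reals: rescaling by \<open>1 / c\<close>
  undoes rescaling by \<open>c\<close>. Hence each of the one-way statements, applied to \<open>c\<close> and
  to \<open>1 / c\<close>, is an equivalence, and \<open>\<xi> \<mapsto> rescale_noise c \<xi>\<close> is a
  bijection between the OU noises of the two equations. The theorem is the case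
  \<open>c = k = 1 - a * \<tau>\<close>. Time scaling does not act on the state, so the gradient of the
  tilted potential is carried along unchanged.
\<close>

section \<open>Rescaling as a group action\<close>

lemma rescale_noise_rescale_noise:
  assumes "b > 0" "c > 0"
  shows "rescale_noise b (rescale_noise c \<xi>) = rescale_noise (c * b) \<xi>"
  using assms by (auto simp: rescale_noise_def fun_eq_iff real_sqrt_mult mult_ac)

lemma rescale_noise_1 [simp]: "rescale_noise 1 \<xi> = \<xi>"
  by (simp add: rescale_noise_def)

lemma rescale_noise_inverse:
  assumes "c > 0"
  shows "rescale_noise (1 / c) (rescale_noise c \<xi>) = \<xi>"
    and "rescale_noise c (rescale_noise (1 / c) \<xi>) = \<xi>"
  using assms by (simp_all add: rescale_noise_rescale_noise)

section \<open>Rescaling of the Ornstein-Uhlenbeck noise\<close>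

lemma diag_matrix_scaleR: "diag_matrix (k *\<^sub>R d) = k *\<^sub>R diag_matrix d"
  by (simp add: diag_matrix_def vec_eq_iff)

lemma continuous_on_rescale_path:
  fixes f :: "real \<Rightarrow> 'a::real_normed_vector"
  assumes "continuous_on UNIV f"
  shows "continuous_on UNIV (\<lambda>s. k *\<^sub>R f (c * s))"
  by (intro continuous_intros continuous_on_compose2[OF assms]) auto

text \<open>An increment over \<open>{r..t}\<close> of the rescaled process is \<open>1 / sqrt c\<close> times an increment over an
  interval of length \<open>c * (t - r)\<close>, so its variance is again \<open>t - r\<close>; independence survives
  because a partition scaled by \<open>c\<close> is again a partition.\<close>

lemma standard_wiener_rescale:
  assumes W: "standard_wiener M W" and c: "c > 0"
  shows "standard_wiener M (\<lambda>s \<omega>. (1 / sqrt c) *\<^sub>R W (c * s) \<omega>)"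
proof -
  interpret prob_space M using W by (simp add: standard_wiener_def)
  have meas: "W t \<in> borel_measurable M" for t
    using W by (simp add: standard_wiener_def)
  have zero: "AE \<omega> in M. W 0 \<omega> = 0" and cont: "AE \<omega> in M. continuous_on UNIV (\<lambda>t. W t \<omega>)"
    using W by (simp_all add: standard_wiener_def)
  have incr: "distributed M lborel (\<lambda>\<omega>. W t \<omega> $ l - W r \<omega> $ l) (normal_density 0 (sqrt (t - r)))"
    if "r < t" for r t l
    using W that by (simp add: standard_wiener_def)
  have indep: "indep_vars (\<lambda>_. borel)
      (\<lambda>(k, l) \<omega>. W (t (Suc k)) \<omega> $ l - W (t k) \<omega> $ l) UNIV" if "strict_mono t" for t
    using W that by (simp add: standard_wiener_def)
  show ?thesis
    unfolding standard_wiener_def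
  proof (intro conjI allI impI)
    show "prob_space M" by (rule prob_space_axioms)
    show "(\<lambda>\<omega>. (1 / sqrt c) *\<^sub>R W (c * t) \<omega>) \<in> borel_measurable M" for t
      using meas[of "c * t"] by measurable
    show "AE \<omega> in M. (1 / sqrt c) *\<^sub>R W (c * 0) \<omega> = 0"
      using zero by simp
    show "AE \<omega> in M. continuous_on UNIV (\<lambda>t. (1 / sqrt c) *\<^sub>R W (c * t) \<omega>)"
      using cont by eventually_elim (rule continuous_on_rescale_path)
    show "distributed M lborel
        (\<lambda>\<omega>. ((1 / sqrt c) *\<^sub>R W (c * t) \<omega>) $ l - ((1 / sqrt c) *\<^sub>R W (c * r) \<omega>) $ l)
        (normal_density 0 (sqrt (t - r)))" if "r < t" for r t l
    proof -
      have *: "distributed M lborel (\<lambda>\<omega>. W (c * t) \<omega> $ l - W (c * r) \<omega> $ l)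
          (normal_density 0 (sqrt (c * t - c * r)))"
        using that c by (intro incr) simp
      have sd: "\<bar>1 / sqrt c\<bar> * sqrt (c * t - c * r) = sqrt (t - r)"
        using c by (simp add: real_sqrt_mult flip: right_diff_distrib)
      show ?thesis
        using normal_density_affine[OF *, of "1 / sqrt c" 0] that c
        unfolding sd by (simp add: diff_divide_distrib)
    qed
    show "indep_vars (\<lambda>_. borel)
        (\<lambda>(k, l) \<omega>. ((1 / sqrt c) *\<^sub>R W (c * t (Suc k)) \<omega>) $ l - ((1 / sqrt c) *\<^sub>R W (c * t k) \<omega>) $ l)
        UNIV" if "strict_mono t" for t :: "nat \<Rightarrow> real"
    proof -
      have "strict_mono (\<lambda>k. c * t k)"
        using that c by (simp add: strict_mono_def)
      from indep_vars_compose2[OF indep[OF this], of "\<lambda>_ x. x / sqrt c" "\<lambda>_. borel"]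
      show ?thesis
        by (simp add: case_prod_unfold diff_divide_distrib)
    qed
  qed
qed

text \<open>With \<open>u = c * v\<close> the integral of the rescaled noise is \<open>sqrt c / c = 1 / sqrt c\<close> times the
  original one, so both terms on the right of the filter carry the factor \<open>1 / sqrt c\<close>, while
  the increment on the left carries \<open>sqrt c\<close>. The matrix has to absorb the quotient \<open>c\<close>.\<close>

lemma solves_linear_filter_rescale:
  assumes "solves_linear_filter M A W \<xi>" and c: "c > 0"
  shows "solves_linear_filter M (c *\<^sub>R A) (\<lambda>s \<omega>. (1 / sqrt c) *\<^sub>R W (c * s) \<omega>) (rescale_noise c \<xi>)"
proof -
  have meas: "\<xi> t \<in> borel_measurable M" for t
    using assms by (simp add: solves_linear_filter_def)
  have AE: "AE \<omega> in M. continuous_on UNIV (\<lambda>t. \<xi> t \<omega>) \<and>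
      (\<forall>r t. r \<le> t \<longrightarrow>
         \<xi> t \<omega> - \<xi> r \<omega> = - (A *v integral {r..t} (\<lambda>u. \<xi> u \<omega>)) + A *v (W t \<omega> - W r \<omega>))"
    using assms by (simp add: solves_linear_filter_def)
  have sq: "sqrt c / c = 1 / sqrt c"
    using c by (auto simp: field_simps)
  show ?thesis
    unfolding solves_linear_filter_def
  proof (intro conjI allI)
    show "rescale_noise c \<xi> t \<in> borel_measurable M" for t
      unfolding rescale_noise_def using meas[of "c * t"] by measurable
    show "AE \<omega> in M. continuous_on UNIV (\<lambda>t. rescale_noise c \<xi> t \<omega>) \<and>
        (\<forall>r t. r \<le> t \<longrightarrow> rescale_noise c \<xi> t \<omega> - rescale_noise c \<xi> r \<omega> =
           - ((c *\<^sub>R A) *v integral {r..t} (\<lambda>u. rescale_noise c \<xi> u \<omega>)) +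
           (c *\<^sub>R A) *v ((1 / sqrt c) *\<^sub>R W (c * t) \<omega> - (1 / sqrt c) *\<^sub>R W (c * r) \<omega>))"
      using AE
    proof eventually_elim
      case (elim \<omega>)
      show ?case
      proof (intro conjI allI impI)
        show "continuous_on UNIV (\<lambda>t. rescale_noise c \<xi> t \<omega>)"
          unfolding rescale_noise_def using elim by (intro continuous_on_rescale_path) simp
        fix r t :: real
        assume "r \<le> t"
        let ?I = "integral {c * r..c * t} (\<lambda>u. \<xi> u \<omega>)" and ?D = "W (c * t) \<omega> - W (c * r) \<omega>"
        have "(\<lambda>u. u / c) ` {c * r..c * t} = {r..t}"
          using c by (auto simp: image_iff field_simps intro!: bexI[of _ "c * _"])
        then have I: "integral {r..t} (\<lambda>u. rescale_noise c \<xi> u \<omega>) = (1 / sqrt c) *\<^sub>R ?I"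
          using integral_stretch_real[of c "c * r" "c * t" "\<lambda>u. \<xi> u \<omega>"] c
          by (simp add: rescale_noise_def sq)
        have "rescale_noise c \<xi> t \<omega> - rescale_noise c \<xi> r \<omega> =
            sqrt c *\<^sub>R (\<xi> (c * t) \<omega> - \<xi> (c * r) \<omega>)"
          by (simp add: rescale_noise_def scaleR_diff_right)
        also have "\<xi> (c * t) \<omega> - \<xi> (c * r) \<omega> = - (A *v ?I) + A *v ?D"
          using elim \<open>r \<le> t\<close> c by simp
        also have "sqrt c *\<^sub>R \<dots> =
            - ((c *\<^sub>R A) *v ((1 / sqrt c) *\<^sub>R ?I)) + (c *\<^sub>R A) *v ((1 / sqrt c) *\<^sub>R ?D)"
          using c by (simp add: matrix_vector_mult_scaleR real_div_sqrt scaleR_add_right scaleR_diff_right[of "sqrt c"]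
              flip: scaleR_matrix_vector_assoc)
        finally show "rescale_noise c \<xi> t \<omega> - rescale_noise c \<xi> r \<omega> =
            - ((c *\<^sub>R A) *v integral {r..t} (\<lambda>u. rescale_noise c \<xi> u \<omega>)) +
            (c *\<^sub>R A) *v ((1 / sqrt c) *\<^sub>R W (c * t) \<omega> - (1 / sqrt c) *\<^sub>R W (c * r) \<omega>)"
          by (simp add: I scaleR_diff_right)
      qed
    qed
  qed
qed

lemma autocorrelation_rescale_noise:
  assumes "c > 0"
  shows "autocorrelation M (rescale_noise c \<xi>) t1 t2 = c *\<^sub>R autocorrelation M \<xi> (c * t1) (c * t2)"
proof -
  have "(sqrt c * x) * (sqrt c * y) = c * (x * y)" for x y :: real
  proof -
    have "(sqrt c * x) * (sqrt c * y) = (sqrt c * sqrt c) * (x * y)"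
      by (simp only: mult_ac)
    then show ?thesis using assms by simp
  qed
  then show ?thesis
    by (simp only: autocorrelation_def rescale_noise_def vec_eq_iff vec_lambda_beta
        vector_scaleR_component real_scaleR_def integral_mult_right_zero simp_thms)
qed

text \<open>Dividing the correlation times by \<open>c\<close> gives the filter matrix the factor \<open>c\<close>, multiplies the
  stationary variance \<open>1 / (2 * scor)\<close> by \<open>c\<close>, and leaves the exponent
  unchanged because the lag in the new time is shorter by the same factor.\<close>

lemma standard_OU_noise_rescale:
  assumes "standard_OU_noise M scor \<xi>" and c: "c > 0"
  shows "standard_OU_noise M (\<chi> l. scor $ l / c) (rescale_noise c \<xi>)"
proof -
  obtain W where W: "standard_wiener M W"
    and filter: "solves_linear_filter M (diag_matrix (\<chi> l. 1 / scor $ l)) W \<xi>"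
    using assms by (auto simp: standard_OU_noise_def)
  have int: "integrable M (\<lambda>\<omega>. (\<xi> t \<omega> $ l)\<^sup>2)" for t l
    using assms by (simp add: standard_OU_noise_def)
  have ac: "autocorrelation M \<xi> t1 t2 =
      diag_matrix (\<chi> l. 1 / (2 * scor $ l) * exp (- \<bar>t1 - t2\<bar> / scor $ l))" for t1 t2
    using assms by (simp add: standard_OU_noise_def)
  have "c *\<^sub>R diag_matrix (\<chi> l. 1 / scor $ l) = diag_matrix (\<chi> l. 1 / (\<chi> l. scor $ l / c) $ l)"
    unfolding diag_matrix_scaleR[symmetric]
    by (rule arg_cong[of _ _ diag_matrix]) (simp add: vec_eq_iff)
  then have filter': "solves_linear_filter M (diag_matrix (\<chi> l. 1 / (\<chi> l. scor $ l / c) $ l))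
      (\<lambda>s \<omega>. (1 / sqrt c) *\<^sub>R W (c * s) \<omega>) (rescale_noise c \<xi>)"
    using solves_linear_filter_rescale[OF filter c] by simp
  have lag: "\<bar>c * t1 - c * t2\<bar> = c * \<bar>t1 - t2\<bar>" for t1 t2
    using c by (simp add: abs_mult flip: right_diff_distrib)
  have "autocorrelation M (rescale_noise c \<xi>) t1 t2 =
      diag_matrix (\<chi> l. 1 / (2 * (\<chi> l. scor $ l / c) $ l) *
        exp (- \<bar>t1 - t2\<bar> / (\<chi> l. scor $ l / c) $ l))" for t1 t2
    unfolding autocorrelation_rescale_noise[OF c] ac lag diag_matrix_scaleR[symmetric]
    by (rule arg_cong[of _ _ diag_matrix]) (simp add: vec_eq_iff mult_ac)
  moreover have "integrable M (\<lambda>\<omega>. (rescale_noise c \<xi> t \<omega> $ l)\<^sup>2)" for t l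
    using int[of "c * t" l] c by (simp add: rescale_noise_def power_mult_distrib)
  ultimately show ?thesis
    unfolding standard_OU_noise_def using standard_wiener_rescale[OF W c] filter' by blast
qed

lemma standard_OU_noise_rescale_iff:
  assumes c: "c > 0"
  shows "standard_OU_noise M (\<chi> l. scor $ l / c) (rescale_noise c \<xi>) \<longleftrightarrow> standard_OU_noise M scor \<xi>"
proof
  assume "standard_OU_noise M (\<chi> l. scor $ l / c) (rescale_noise c \<xi>)"
  from standard_OU_noise_rescale[OF this, of "1 / c"] show "standard_OU_noise M scor \<xi>"
    using c by (simp add: rescale_noise_inverse)
qed (rule standard_OU_noise_rescale[OF _ c])

section \<open>Rescaling of the equation\<close>

text \<open>The chain rule multiplies the derivative by \<open>c\<close>, which the factor \<open>k / c\<close> in front of it undoes.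
  The derivatives are taken within the time set, so the image of \<open>T\<close> under the inverse
  substitution has to be the new time set exactly.\<close>

lemma solves_sde_rescale:
  assumes "solves_sde M T k U S \<eta> X" and c: "c > 0"
  shows "solves_sde M ((\<lambda>t. t / c) ` T) (k / c) U (\<lambda>x. (1 / sqrt c) *\<^sub>R S x)
    (rescale_noise c \<eta>) (rescale_time c X)"
proof -
  have "AE \<omega> in M. \<forall>t\<in>T. \<exists>D. ((\<lambda>t. X t \<omega>) has_vector_derivative D) (at t within T) \<and>
      k *\<^sub>R D = - grad U (X t \<omega>) + S (X t \<omega>) *v \<eta> t \<omega>"
    using assms by (simp add: solves_sde_def)
  then have "AE \<omega> in M. \<forall>s\<in>(\<lambda>t. t / c) ` T.
      \<exists>D. ((\<lambda>s. rescale_time c X s \<omega>) has_vector_derivative D) (at s within (\<lambda>t. t / c) ` T) \<and>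
        (k / c) *\<^sub>R D = - grad U (rescale_time c X s \<omega>) +
          ((1 / sqrt c) *\<^sub>R S (rescale_time c X s \<omega>)) *v rescale_noise c \<eta> s \<omega>"
  proof eventually_elim
    case (elim \<omega>)
    show ?case
    proof
      fix s assume "s \<in> (\<lambda>t. t / c) ` T"
      then have t: "c * s \<in> T" using c by auto
      then obtain D where D: "((\<lambda>t. X t \<omega>) has_vector_derivative D) (at (c * s) within T)"
        and eq: "k *\<^sub>R D = - grad U (X (c * s) \<omega>) + S (X (c * s) \<omega>) *v \<eta> (c * s) \<omega>"
        using elim by blast
      have "(*) c ` (\<lambda>t. t / c) ` T = T"
        using c by (simp add: image_image)
      moreover have "((*) c has_vector_derivative c) (at s within (\<lambda>t. t / c) ` T)"
        by (auto intro!: derivative_eq_intros simp flip: has_real_derivative_iff_has_vector_derivative)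
      ultimately have "((\<lambda>s. rescale_time c X s \<omega>) has_vector_derivative c *\<^sub>R D)
          (at s within (\<lambda>t. t / c) ` T)"
        using vector_diff_chain_within[of "(*) c" c s "(\<lambda>t. t / c) ` T" "\<lambda>t. X t \<omega>" D] D
        by (simp add: rescale_time_def o_def)
      moreover have "(k / c) *\<^sub>R (c *\<^sub>R D) = - grad U (rescale_time c X s \<omega>) +
          ((1 / sqrt c) *\<^sub>R S (rescale_time c X s \<omega>)) *v rescale_noise c \<eta> s \<omega>"
        using c eq by (simp add: rescale_time_def rescale_noise_def matrix_vector_mult_scaleR
            flip: scaleR_matrix_vector_assoc)
      ultimately show "\<exists>D. ((\<lambda>s. rescale_time c X s \<omega>) has_vector_derivative D)
            (at s within (\<lambda>t. t / c) ` T) \<and>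
          (k / c) *\<^sub>R D = - grad U (rescale_time c X s \<omega>) +
            ((1 / sqrt c) *\<^sub>R S (rescale_time c X s \<omega>)) *v rescale_noise c \<eta> s \<omega>"
        by blast
    qed
  qed
  moreover have "\<forall>s\<in>(\<lambda>t. t / c) ` T. rescale_time c X s \<in> borel_measurable M"
    using assms by (auto simp: solves_sde_def rescale_time_def)
  ultimately show ?thesis
    unfolding solves_sde_def by blast
qed

lemma solves_sde_rescale_iff:
  assumes c: "c > 0"
  shows "solves_sde M ((\<lambda>t. t / c) ` T) (k / c) U (\<lambda>x. (1 / sqrt c) *\<^sub>R S x)
      (rescale_noise c \<eta>) (rescale_time c X) \<longleftrightarrow> solves_sde M T k U S \<eta> X"
    (is "?rescaled \<longleftrightarrow> _")
proof
  assume ?rescaled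
  from solves_sde_rescale[OF this, of "1 / c"] show "solves_sde M T k U S \<eta> X"
    using c by (simp add: rescale_noise_inverse rescale_time_def image_image real_sqrt_divide)
qed (rule solves_sde_rescale[OF _ c])

theorem corollary1:
  fixes M :: "'w measure"
    and V :: "real ^ 'n \<Rightarrow> real"
    and \<sigma> :: "real ^ 'n \<Rightarrow> real ^ 'm ^ 'n"
    and a \<tau> :: real
    and xhat :: "real ^ 'n"
    and scor :: "real ^ 'm"
    and T :: "real set"
    and X :: "real \<Rightarrow> 'w \<Rightarrow> real ^ 'n"
  assumes "prob_space M"
    and "\<forall>x. V differentiable (at x)"
    and "\<tau> > 0" and "a * \<tau> < 1"
    and "\<forall>l. scor $ l > 0"
  defines "c \<equiv> 1 - a * \<tau>"
  defines "V' \<equiv> tilted_potential V a xhat"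
  defines "\<sigma>' \<equiv> (\<lambda>x. (1 / sqrt c) *\<^sub>R \<sigma> x)"
  defines "scor' \<equiv> (\<chi> l. scor $ l / c)"
  defines "T' \<equiv> (\<lambda>t. t / c) ` T"
  shows "(\<forall>\<xi>. standard_OU_noise M scor \<xi> \<longleftrightarrow> standard_OU_noise M scor' (rescale_noise c \<xi>)) \<and>
    (\<forall>\<xi>. standard_OU_noise M scor \<xi> \<longrightarrow>
       (solves_sde M T c V' \<sigma> \<xi> X \<longleftrightarrow>
        solves_sde M T' 1 V' \<sigma>' (rescale_noise c \<xi>) (rescale_time c X))) \<and>
    ((\<exists>\<xi>. standard_OU_noise M scor \<xi> \<and> solves_sde M T c V' \<sigma> \<xi> X) \<longleftrightarrow>
     (\<exists>\<xi>'. standard_OU_noise M scor' \<xi>' \<and> solves_sde M T' 1 V' \<sigma>' \<xi>' (rescale_time c X)))"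
proof -
  have c: "c > 0"
    using assms(4) by (simp add: c_def)
  have noise: "standard_OU_noise M scor \<xi> \<longleftrightarrow> standard_OU_noise M scor' (rescale_noise c \<xi>)" for \<xi>
    unfolding scor'_def by (rule standard_OU_noise_rescale_iff[OF c, symmetric])
  have sde: "solves_sde M T c V' \<sigma> \<xi> X \<longleftrightarrow>
      solves_sde M T' 1 V' \<sigma>' (rescale_noise c \<xi>) (rescale_time c X)" for \<xi>
    using solves_sde_rescale_iff[OF c, of M T c V' \<sigma> \<xi> X] c by (simp add: T'_def \<sigma>'_def)
  \<comment> \<open>Every OU noise in the rescaled time is the rescaling of one in the original time.\<close>
  have "\<exists>\<xi>. standard_OU_noise M scor \<xi> \<and> solves_sde M T c V' \<sigma> \<xi> X"
    if "standard_OU_noise M scor' \<xi>'" "solves_sde M T' 1 V' \<sigma>' \<xi>' (rescale_time c X)" for \<xi>'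
    using that by (intro exI[of _ "rescale_noise (1 / c) \<xi>'"])
      (simp add: noise sde rescale_noise_inverse[OF c])
  then show ?thesis
    using noise sde by blast
qed

end
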